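(* Let $K,K'$ be independent and identically distributed random variables with values in $\mathbb N=\{1,2,\ldots\}$, with a non-increasing probability mass function on $\mathbb N$ (that is, $k\mapsto\mathbb P(K=k)$ is non-increasing on $\{1,2,\ldots\}$) and finite mean. Then $$\mathbb E[\max\{K,K'\}]\ \ge\ \frac43\,\mathbb E[K]-\frac13.$$ *)

theory Defs
  imports "HOL-Probability.Probability"
begin

end

theory Submission
  imports Defs
begin

text \<open>
  Write \<open>G n = P(K > n)\<close>. Summing tails gives \<open>E K = \<Sum>n. G n\<close>, and independence turns the tail of the
  maximum into \<open>1 - (1 - G n)\<^sup>2 = 2 * G n - (G n)\<^sup>2\<close>, so that
  \<open>E (max K K') = 2 * (\<Sum>n. G n) - (\<Sum>n. (G n)\<^sup>2)\<close>. As \<open>G 0 = 1\<close>, the claim becomes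
  \<open>3 * (\<Sum>n. (G n)\<^sup>2) \<le> 2 * G 0 * (\<Sum>n. G n) + (G 0)\<^sup>2\<close>.

  The decrements of \<open>G\<close> are the values of the mass function, so the monotonicity hypothesis says
  that \<open>G\<close> is convex, and the inequality above is a fact about summable convex sequences
  (\<open>convex_suminf_square_le\<close>). In this homogeneous form it also applies to every shifted sequence
  \<open>G n, G (n + 1), \<dots>\<close>. Subtracting the forms for two consecutive shifts leaves
  \<open>(G (n + 1))\<^sup>2 \<le> 2 * (G n - G (n + 1)) * (\<Sum>k. G (n + 1 + k))\<close>
  (\<open>convex_square_le_tail\<close>): beyond \<open>n + 1\<close> a convex sequence lies above the line of slope
  \<open>G (n + 1) - G n\<close>, hence its tail sum is at least the area of the triangle which that line cuts
  off. The bound is attained when \<open>K\<close> is constantly \<open>1\<close>.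
\<close>

lemma summable_convex_seq_bounds:
  fixes G :: "nat \<Rightarrow> real"
  assumes sm: "summable G" and conv: "decseq (\<lambda>n. G n - G (Suc n))"
  shows "G (Suc n) \<le> G n" and "0 \<le> G n"
proof -
  have lim: "G \<longlonglongrightarrow> 0"
    using sm by (rule summable_LIMSEQ_zero)
  have "(\<lambda>n. G n - G (Suc n)) \<longlonglongrightarrow> 0 - 0"
    by (intro tendsto_diff lim LIMSEQ_Suc)
  then have step: "G (Suc n) \<le> G n" for n
    using decseq_ge[OF conv, of 0 n] by simp
  show "G (Suc n) \<le> G n"
    by (rule step)
  have "decseq G"
    using step by (rule decseq_SucI)
  then show "0 \<le> G n"
    using lim by (rule decseq_ge)
qed

text \<open>
  The comparison of the tail sum with a triangle, done algebraically: beyond \<open>n\<close> all decrements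
  are at most \<open>p = G n - G (Suc n)\<close>, so \<open>(G k)\<^sup>2 - (G (Suc k))\<^sup>2 \<le> p * (G k + G (Suc k)) \<le> 2 * p * G k\<close>,
  and the left-hand side telescopes.
\<close>

lemma convex_square_le_tail:
  fixes G :: "nat \<Rightarrow> real"
  assumes sm: "summable G" and conv: "decseq (\<lambda>n. G n - G (Suc n))"
  shows "(G (Suc n))\<^sup>2 \<le> 2 * (G n - G (Suc n)) * (\<Sum>k. G (k + Suc n))"
proof -
  define p where "p = G n - G (Suc n)"
  define H where "H = (\<lambda>k. G (k + Suc n))"
  note bounds = summable_convex_seq_bounds[OF sm conv]
  have H: "summable H"
    unfolding H_def using sm by (rule summable_ignore_initial_segment)
  have "(\<lambda>k. (H k)\<^sup>2) \<longlonglongrightarrow> 0\<^sup>2"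
    by (intro tendsto_power summable_LIMSEQ_zero H)
  then have tele: "(\<lambda>k. (H k)\<^sup>2 - (H (Suc k))\<^sup>2) sums ((H 0)\<^sup>2 - 0\<^sup>2)"
    by (rule telescope_sums')
  have le: "(H k)\<^sup>2 - (H (Suc k))\<^sup>2 \<le> 2 * p * H k" for k
  proof -
    have "0 \<le> p"
      using bounds(1)[of n] by (simp add: p_def)
    have "0 \<le> H (Suc k)" and "H (Suc k) \<le> H k"
      using bounds by (simp_all add: H_def)
    have "(H k)\<^sup>2 - (H (Suc k))\<^sup>2 = (H k - H (Suc k)) * (H k + H (Suc k))"
      by (simp add: power2_eq_square algebra_simps)
    also have "\<dots> \<le> p * (H k + H (Suc k))"
    proof (rule mult_right_mono)
      show "H k - H (Suc k) \<le> p"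
        using decseqD[OF conv, of n "k + Suc n"] by (simp add: H_def p_def)
    qed (use \<open>0 \<le> H (Suc k)\<close> \<open>H (Suc k) \<le> H k\<close> in linarith)
    also have "\<dots> \<le> p * (2 * H k)"
      using \<open>0 \<le> p\<close> \<open>H (Suc k) \<le> H k\<close> by (intro mult_left_mono) auto
    finally show ?thesis
      by simp
  qed
  have "(\<lambda>k. 2 * p * H k) sums (2 * p * suminf H)"
    by (intro sums_mult summable_sums H)
  with le tele have "(H 0)\<^sup>2 - 0\<^sup>2 \<le> 2 * p * suminf H"
    by (rule sums_le)
  then show ?thesis
    unfolding H_def p_def by simp
qed

lemma convex_suminf_square_le:
  fixes G :: "nat \<Rightarrow> real"
  assumes sm: "summable G" and conv: "decseq (\<lambda>n. G n - G (Suc n))"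
  shows "summable (\<lambda>n. (G n)\<^sup>2)"
    and "3 * (\<Sum>n. (G n)\<^sup>2) \<le> 2 * G 0 * (\<Sum>n. G n) + (G 0)\<^sup>2"
proof -
  define T where "T n = (\<Sum>k. G (k + n))" for n
  define \<Phi> where "\<Phi> n = 2 * G n * T n + (G n)\<^sup>2" for n
  note nonneg = summable_convex_seq_bounds(2)[OF sm conv]
  have T_Suc: "T n = G n + T (Suc n)" for n
    using suminf_split_head[OF summable_ignore_initial_segment[OF sm, of n]]
    by (simp add: T_def)
  \<comment> \<open>\<open>\<Phi> n\<close> is the bound for the sequence shifted by \<open>n\<close>; it pays for the terms one by one.\<close>
  have step: "3 * (G n)\<^sup>2 \<le> \<Phi> n - \<Phi> (Suc n)" for n
    using convex_square_le_tail[OF sm conv, of n]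
    unfolding \<Phi>_def T_Suc[of n] T_def[of "Suc n", symmetric]
    by (simp add: power2_eq_square algebra_simps)
  have \<Phi>_nonneg: "0 \<le> \<Phi> n" for n
    using nonneg unfolding \<Phi>_def T_def
    by (intro add_nonneg_nonneg mult_nonneg_nonneg suminf_nonneg
        summable_ignore_initial_segment sm) auto
  have partial: "(\<Sum>n<N. 3 * (G n)\<^sup>2) \<le> \<Phi> 0" for N
  proof -
    have "(\<Sum>n<N. 3 * (G n)\<^sup>2) \<le> (\<Sum>n<N. \<Phi> n - \<Phi> (Suc n))"
      by (intro sum_mono step)
    also have "\<dots> = \<Phi> 0 - \<Phi> N"
      by (rule sum_lessThan_telescope')
    finally show ?thesis
      using \<Phi>_nonneg[of N] by linarith
  qed
  have sm3: "summable (\<lambda>n. 3 * (G n)\<^sup>2)"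
    by (rule summableI_nonneg_bounded[OF _ partial]) simp
  then show sq: "summable (\<lambda>n. (G n)\<^sup>2)"
    by simp
  have "3 * (\<Sum>n. (G n)\<^sup>2) = (\<Sum>n. 3 * (G n)\<^sup>2)"
    by (rule suminf_mult[OF sq, symmetric])
  also have "\<dots> \<le> \<Phi> 0"
    by (rule suminf_le_const[OF sm3 partial])
  finally show "3 * (\<Sum>n. (G n)\<^sup>2) \<le> 2 * G 0 * (\<Sum>n. G n) + (G 0)\<^sup>2"
    by (simp add: \<Phi>_def T_def)
qed

lemma (in finite_measure) tail_measure_sums_integral_nat:
  fixes X :: "'a \<Rightarrow> nat"
  assumes X: "X \<in> measurable M (count_space UNIV)"
    and int: "integrable M (\<lambda>x. real (X x))"
  shows "(\<lambda>n. measure M {x \<in> space M. n < X x}) sums (\<integral>x. real (X x) \<partial>M)"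
proof -
  have "(\<lambda>n. ennreal (measure M {x \<in> space M. n < X x}))
      sums (\<Sum>n. ennreal (measure M {x \<in> space M. n < X x}))"
    by (intro summable_sums) simp
  also have "(\<Sum>n. ennreal (measure M {x \<in> space M. n < X x})) = (\<integral>\<^sup>+x. of_nat (X x) \<partial>M)"
    by (simp add: nn_integral_nat_function[OF X] emeasure_eq_measure)
  also have "\<dots> = ennreal (\<integral>x. real (X x) \<partial>M)"
    using nn_integral_eq_integral[OF int] by (simp add: ennreal_of_nat_eq_real_of_nat)
  finally show ?thesis
    by simp
qed

lemma (in prob_space) prob_less_max_iid:
  fixes X Y :: "'a \<Rightarrow> 'b :: linorder"
  assumes indep: "indep_var (count_space UNIV) X (count_space UNIV) Y"
    and ident: "distr M (count_space UNIV) X = distr M (count_space UNIV) Y"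
  shows "prob {x \<in> space M. a < max (X x) (Y x)}
    = 2 * prob {x \<in> space M. a < X x} - (prob {x \<in> space M. a < X x})\<^sup>2"
proof -
  have X [measurable]: "X \<in> measurable M (count_space UNIV)"
    and Y [measurable]: "Y \<in> measurable M (count_space UNIV)"
    using indep by (auto dest: indep_var_rv1 indep_var_rv2)
  have X_le [measurable]: "{x \<in> space M. X x \<le> a} \<in> events"
    using measurable_sets[OF X, of "{..a}"] by (simp add: vimage_def Int_def conj_commute)
  have Y_le [measurable]: "{x \<in> space M. Y x \<le> a} \<in> events"
    using measurable_sets[OF Y, of "{..a}"] by (simp add: vimage_def Int_def conj_commute)
  have both: "{x \<in> space M. X x \<le> a \<and> Y x \<le> a} \<in> events"
    by measurable
  have eq: "prob {x \<in> space M. X x \<le> a} = prob {x \<in> space M. Y x \<le> a}"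
    using measure_distr[OF X, of "{..a}"] measure_distr[OF Y, of "{..a}"] ident
    by (simp add: vimage_def Int_def conj_commute)
  have tail: "prob {x \<in> space M. a < X x} = 1 - prob {x \<in> space M. X x \<le> a}"
    using prob_neg[OF X_le] by (simp add: not_le)
  have "prob {x \<in> space M. a < max (X x) (Y x)}
      = prob {x \<in> space M. \<not> (X x \<le> a \<and> Y x \<le> a)}"
    by (intro arg_cong[where f = prob]) (auto simp: less_max_iff_disj not_le)
  also have "\<dots> = 1 - prob {x \<in> space M. X x \<le> a \<and> Y x \<le> a}"
    using both by (rule prob_neg)
  also have "prob {x \<in> space M. X x \<le> a \<and> Y x \<le> a}
      = prob {x \<in> space M. X x \<le> a} * prob {x \<in> space M. Y x \<le> a}"
    using prob_indep_random_variable[OF indep, of "{..a}" "{..a}"] by simp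
  finally show ?thesis
    unfolding eq[symmetric] tail by (simp add: power2_eq_square algebra_simps)
qed

theorem lemma4p2:
  fixes M :: "'a measure" and K K' :: "'a \<Rightarrow> nat"
  assumes prob: "prob_space M"
    and rv: "K \<in> measurable M (count_space UNIV)" "K' \<in> measurable M (count_space UNIV)"
    and pos: "\<And>\<omega>. \<omega> \<in> space M \<Longrightarrow> 1 \<le> K \<omega>" "\<And>\<omega>. \<omega> \<in> space M \<Longrightarrow> 1 \<le> K' \<omega>"
    and indep: "prob_space.indep_var M (count_space UNIV) K (count_space UNIV) K'"
    and ident: "distr M (count_space UNIV) K = distr M (count_space UNIV) K'"
    and noninc: "\<And>j k. 1 \<le> j \<Longrightarrow> j \<le> k \<Longrightarrow>
        measure M {\<omega> \<in> space M. K \<omega> = k} \<le> measure M {\<omega> \<in> space M. K \<omega> = j}"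
    and fin_mean: "integrable M (\<lambda>\<omega>. real (K \<omega>))"
  shows "(\<integral>\<omega>. real (max (K \<omega>) (K' \<omega>)) \<partial>M) \<ge> 4 / 3 * (\<integral>\<omega>. real (K \<omega>) \<partial>M) - 1 / 3"
proof -
  interpret prob_space M
    by (rule prob)
  note [measurable] = rv
  define G where "G n = prob {\<omega> \<in> space M. n < K \<omega>}" for n
  have K'_int: "integrable M (\<lambda>\<omega>. real (K' \<omega>))"
    using fin_mean ident integrable_distr_eq[OF rv(1), of real] integrable_distr_eq[OF rv(2), of real]
    by simp
  have max_int: "integrable M (\<lambda>\<omega>. real (max (K \<omega>) (K' \<omega>)))"
    unfolding of_nat_max using fin_mean K'_int by (rule integrable_max)

  have G_sums: "G sums (\<integral>\<omega>. real (K \<omega>) \<partial>M)"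
    unfolding G_def using rv(1) fin_mean by (rule tail_measure_sums_integral_nat)
  have max_sums: "(\<lambda>n. 2 * G n - (G n)\<^sup>2) sums (\<integral>\<omega>. real (max (K \<omega>) (K' \<omega>)) \<partial>M)"
    using tail_measure_sums_integral_nat[OF _ max_int]
    by (simp add: prob_less_max_iid[OF indep ident] G_def)

  have "G n = G (Suc n) + prob {\<omega> \<in> space M. K \<omega> = Suc n}" for n
  proof -
    have "{\<omega> \<in> space M. n < K \<omega>}
        = {\<omega> \<in> space M. Suc n < K \<omega>} \<union> {\<omega> \<in> space M. K \<omega> = Suc n}"
      by auto
    then show ?thesis
      unfolding G_def by (simp, subst finite_measure_Union) auto
  qed
  then have decrement: "G n - G (Suc n) = prob {\<omega> \<in> space M. K \<omega> = Suc n}" for n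
    by (metis add_diff_cancel_left')
  have conv: "decseq (\<lambda>n. G n - G (Suc n))"
    unfolding decrement by (intro decseq_SucI noninc) auto
  have G_0: "G 0 = 1"
    unfolding G_def using pos(1) by (intro prob_eq_1[THEN iffD2] AE_I2) (auto simp: Suc_le_eq)

  have G_summable: "summable G"
    using G_sums by (rule sums_summable)
  note sq = convex_suminf_square_le[OF G_summable conv]
  have "(\<lambda>n. 2 * G n - (G n)\<^sup>2) sums (2 * (\<Sum>n. G n) - (\<Sum>n. (G n)\<^sup>2))"
    by (intro sums_diff sums_mult summable_sums G_summable sq(1))
  with max_sums
  have "(\<integral>\<omega>. real (max (K \<omega>) (K' \<omega>)) \<partial>M) = 2 * (\<Sum>n. G n) - (\<Sum>n. (G n)\<^sup>2)"
    by (rule sums_unique2)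
  moreover have "(\<integral>\<omega>. real (K \<omega>) \<partial>M) = (\<Sum>n. G n)"
    using G_sums by (rule sums_unique)
  ultimately show ?thesis
    using sq(2) by (simp add: G_0)
qed

end
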